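(* Let $K\subset\mathbb{C}^d$ be a compact set which is polynomially convex and $L$-regular. For each $n=1,2,\dots$ let $A_n=\{A_{n1},\dots,A_{nN}\}\subset K$, $N=N(n)=\binom{n+d}{n}$, be a set of $N$ points with $VDM(A_{n1},\dots,A_{nN})\neq 0$. Let $\Lambda_n$ be the $n$-th Lebesgue constant for $K,A_n$, and for $f\in C(K)$ let $L_nf$ be the Lagrange interpolating polynomial of $f$ at the points of $A_n$. If $\limsup_{n\to\infty}\Lambda_n^{1/n}=1$, then for each $f\in C(K)$, $$\limsup_{n\to\infty}\|f-L_nf\|_K^{1/n}=\limsup_{n\to\infty} d_n(f,K)^{1/n}.$$
   Context: $\mathcal{P}_n$ is the complex vector space of holomorphic polynomials on $\mathbb{C}^d$ of degree at most $n$, with $\dim\mathcal{P}_n=N=N(n)=\binom{n+d}{n}$, and $e_1,\dots,e_N$ are the standard basis monomials $z^{\alpha}$, $|\alpha|\le n$, of $\mathcal{P}_n$. For $\zeta_1,\dots,\zeta_N\in\mathbb{C}^d$, $VDM(\zeta_1,\dots,\zeta_N)=\det[e_i(\zeta_j)]_{i,j=1,\dots,N}$. If $VDM(A_{n1},\dots,A_{nN})\ne 0$, the fundamental Lagrange interpolating polynomials are $$l_{nj}(z)=\frac{VDM(A_{n1},\dots,z,\dots,A_{nN})}{VDM(A_{n1},\dots,A_{nN})},\quad j=1,\dots,N,$$ with $z$ in the $j$-th slot in the numerator; they lie in $\mathcal{P}_n$ and satisfy $l_{nj}(A_{ni})=\delta_{ji}$. The Lagrange interpolating polynomial of a function $f$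 defined at the points of $A_n$ is $L_nf=\sum_{j=1}^N f(A_{nj})\,l_{nj}\in\mathcal{P}_n$. The $n$-th Lebesgue constant is $\Lambda_n=\sup_{z\in K}\sum_{j=1}^N|l_{nj}(z)|$. $C(K)$ is the space of continuous complex-valued functions on $K$, $\|g\|_K=\sup_{z\in K}|g(z)|$, and $d_n(f,K)=\inf\{\|f-p\|_K: p\in\mathcal{P}_n\}$. $K$ is polynomially convex if $K=\{z\in\mathbb{C}^d: |p(z)|\le\|p\|_K \text{ for all polynomials } p\}$. The extremal function of $K$ is $V_K(z)=\sup\{\frac{1}{\deg p}\log|p(z)|: p \text{ a nonconstant polynomial},\ \|p\|_K\le 1\}$, and $V_K^*(z)=\limsup_{\zeta\to z}V_K(\zeta)$. $K$ is $L$-regular if $V_K=V_K^*$. *)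

theory Defs
  imports "HOL-Analysis.Analysis" "Jordan_Normal_Form.Determinant"
begin

text \<open>\<open>\<complex>\<^sup>d\<close> is the type \<open>complex ^ 'd\<close> with \<open>d = CARD('d)\<close>; a multi-index is a function \<open>'d \<Rightarrow> nat\<close>.\<close>

no_notation Matrix.vec_index (infixl "$" 100)

definition multi_indices :: "nat \<Rightarrow> ('d::finite \<Rightarrow> nat) set" where
  "multi_indices n = {\<alpha>. (\<Sum>k\<in>UNIV. \<alpha> k) \<le> n}"

definition cmonom :: "('d::finite \<Rightarrow> nat) \<Rightarrow> complex ^ 'd \<Rightarrow> complex" where
  "cmonom \<alpha> z = (\<Prod>k\<in>UNIV. (z $ k) ^ \<alpha> k)"

definition polys_upto :: "nat \<Rightarrow> (complex ^ 'd::finite \<Rightarrow> complex) set" where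
  "polys_upto n = {p. \<exists>c. p = (\<lambda>z. \<Sum>\<alpha>\<in>multi_indices n. c \<alpha> * cmonom \<alpha> z)}"

definition polys :: "(complex ^ 'd::finite \<Rightarrow> complex) set" where
  "polys = (\<Union>n. polys_upto n)"

text \<open>Total degree of a polynomial function (only meaningful on \<^const>\<open>polys\<close>; the zero polynomial gets degree 0).\<close>
definition cpoly_degree :: "(complex ^ 'd::finite \<Rightarrow> complex) \<Rightarrow> nat" where
  "cpoly_degree p = (LEAST n. p \<in> polys_upto n)"

definition ncoeffs :: "'d::finite itself \<Rightarrow> nat \<Rightarrow> nat" where
  "ncoeffs _ n = (n + CARD('d)) choose n"

lemma card_bounded_sum:
  assumes "finite S"
  shows "finite {\<alpha>::'a \<Rightarrow> nat. (\<forall>i. i \<notin> S \<longrightarrow> \<alpha> i = 0) \<and> sum \<alpha> S \<le> n} \<and>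
         card {\<alpha>::'a \<Rightarrow> nat. (\<forall>i. i \<notin> S \<longrightarrow> \<alpha> i = 0) \<and> sum \<alpha> S \<le> n} = (n + card S) choose n"
  using assms
proof (induction S arbitrary: n rule: finite_induct)
  case empty
  have "{\<alpha>::'a \<Rightarrow> nat. (\<forall>i. i \<notin> {} \<longrightarrow> \<alpha> i = 0) \<and> sum \<alpha> {} \<le> n} = {\<lambda>_. 0}"
    by (auto simp: fun_eq_iff)
  then show ?case by simp
next
  case (insert x S)
  let ?M = "\<lambda>S n. {\<alpha>::'a \<Rightarrow> nat. (\<forall>i. i \<notin> S \<longrightarrow> \<alpha> i = 0) \<and> sum \<alpha> S \<le> n}"
  have upd: "(\<Sum>i\<in>S. if i = x then k else \<alpha> i) = sum \<alpha> S" for \<alpha> :: "'a \<Rightarrow> nat" and k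
    using insert.hyps by (intro sum.cong) auto
  have bij: "bij_betw (\<lambda>(k, \<alpha>). \<alpha>(x := n - k)) (SIGMA k:{..n}. ?M S k) (?M (insert x S) n)"
    by (rule bij_betw_byWitness[where f' = "\<lambda>\<alpha>. (n - \<alpha> x, \<alpha>(x := 0))"])
       (use insert.hyps in \<open>auto simp: upd split: if_splits\<close>)
  have "finite (SIGMA k:{..n}. ?M S k)"
    using insert.IH by (intro finite_SigmaI) auto
  moreover have "card (SIGMA k:{..n}. ?M S k) = (\<Sum>k\<le>n. (card S + k) choose k)"
    using insert.IH by (subst card_SigmaI) (auto simp: add.commute)
  ultimately show ?case
    using bij_betw_finite[OF bij] bij_betw_same_card[OF bij] insert.hyps
      sum_choose_lower[of "card S" n]
    by (simp add: add.commute)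
qed

lemma finite_multi_indices: "finite (multi_indices n :: ('d::finite \<Rightarrow> nat) set)"
  and card_multi_indices: "card (multi_indices n :: ('d::finite \<Rightarrow> nat) set) = ncoeffs TYPE('d) n"
proof -
  have *: "{\<alpha>::'d \<Rightarrow> nat. (\<forall>i. i \<notin> UNIV \<longrightarrow> \<alpha> i = 0) \<and> sum \<alpha> UNIV \<le> n} = multi_indices n"
    by (auto simp: multi_indices_def)
  show "finite (multi_indices n :: ('d \<Rightarrow> nat) set)"
    and "card (multi_indices n :: ('d \<Rightarrow> nat) set) = ncoeffs TYPE('d) n"
    using card_bounded_sum[OF finite_class.finite_UNIV[where ?'a = 'd], of n]
    unfolding * ncoeffs_def by blast+
qed

text \<open>A fixed but arbitrary enumeration \<open>e\<^sub>0, \<dots>, e\<^sub>N\<^sub>-\<^sub>1\<close> of the monomials of degree at most \<open>n\<close>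
  (a different one changes \<open>VDM\<close> only by a sign, and the Lagrange polynomials not at all).\<close>
definition monom_enum :: "nat \<Rightarrow> nat \<Rightarrow> ('d::finite \<Rightarrow> nat)" where
  "monom_enum n = (SOME e. bij_betw e {..<ncoeffs TYPE('d) n} (multi_indices n))"

lemma bij_betw_monom_enum:
  "bij_betw (monom_enum n) {..<ncoeffs TYPE('d) n} (multi_indices n :: ('d::finite \<Rightarrow> nat) set)"
proof -
  have "\<exists>e. bij_betw e {..<ncoeffs TYPE('d) n} (multi_indices n :: ('d \<Rightarrow> nat) set)"
    using ex_bij_betw_nat_finite[OF finite_multi_indices[of n, where ?'d = 'd]]
    by (simp add: card_multi_indices atLeast0LessThan)
  from someI_ex[OF this] show ?thesis
    unfolding monom_enum_def .
qed

definition vdm :: "nat \<Rightarrow> (nat \<Rightarrow> complex ^ 'd::finite) \<Rightarrow> complex" where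
  "vdm n \<zeta> = Determinant.det (Matrix.mat (ncoeffs TYPE('d) n) (ncoeffs TYPE('d) n)
                (\<lambda>(i, j). cmonom (monom_enum n i) (\<zeta> j)))"

definition lagrange_basis :: "nat \<Rightarrow> (nat \<Rightarrow> complex ^ 'd::finite) \<Rightarrow> nat \<Rightarrow> complex ^ 'd \<Rightarrow> complex" where
  "lagrange_basis n a j z = vdm n (a(j := z)) / vdm n a"

definition lagrange_interp ::
  "nat \<Rightarrow> (nat \<Rightarrow> complex ^ 'd::finite) \<Rightarrow> (complex ^ 'd \<Rightarrow> complex) \<Rightarrow> complex ^ 'd \<Rightarrow> complex" where
  "lagrange_interp n a f z = (\<Sum>j<ncoeffs TYPE('d) n. f (a j) * lagrange_basis n a j z)"

text \<open>The real-valued suprema and infima below are the intended ones for compact nonempty \<open>K\<close>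
  and functions continuous on \<open>K\<close>.\<close>

definition lebesgue_const :: "(complex ^ 'd::finite) set \<Rightarrow> nat \<Rightarrow> (nat \<Rightarrow> complex ^ 'd) \<Rightarrow> real" where
  "lebesgue_const K n a = (SUP z\<in>K. \<Sum>j<ncoeffs TYPE('d) n. norm (lagrange_basis n a j z))"

definition norm_on :: "'a set \<Rightarrow> ('a \<Rightarrow> complex) \<Rightarrow> real" where
  "norm_on K g = (SUP z\<in>K. norm (g z))"

definition best_approx :: "nat \<Rightarrow> (complex ^ 'd::finite \<Rightarrow> complex) \<Rightarrow> (complex ^ 'd) set \<Rightarrow> real" where
  "best_approx n f K = (INF p\<in>polys_upto n. norm_on K (\<lambda>z. f z - p z))"

definition polynomially_convex :: "(complex ^ 'd::finite) set \<Rightarrow> bool" where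
  "polynomially_convex K \<longleftrightarrow> K = {z. \<forall>p\<in>polys. norm (p z) \<le> norm_on K p}"

text \<open>Extended-real valued, with \<open>log 0 = -\<infinity>\<close>; the value \<open>\<infinity>\<close> occurs for small (pluripolar) \<open>K\<close>.\<close>
definition extremal_fun :: "(complex ^ 'd::finite) set \<Rightarrow> complex ^ 'd \<Rightarrow> ereal" where
  "extremal_fun K z =
     (SUP p\<in>{p \<in> polys. \<not> p constant_on UNIV \<and> norm_on K p \<le> 1}.
        if p z = 0 then -\<infinity> else ereal (1 / real (cpoly_degree p) * ln (norm (p z))))"

text \<open>Upper semicontinuous regularization; \<open>nhds z\<close> (rather than \<open>at z\<close>) lets \<open>\<zeta> = z\<close> take part.\<close>
definition extremal_fun_reg :: "(complex ^ 'd::finite) set \<Rightarrow> complex ^ 'd \<Rightarrow> ereal" where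
  "extremal_fun_reg K z = Limsup (nhds z) (extremal_fun K)"

definition L_regular :: "(complex ^ 'd::finite) set \<Rightarrow> bool" where
  "L_regular K \<longleftrightarrow> extremal_fun K = extremal_fun_reg K"

end

theory Submission
  imports Defs
begin

text \<open>
  Interpolation is a linear projection of \<open>C(K)\<close> onto \<open>\<P>\<^sub>n\<close>: it reproduces polynomials of
  degree at most \<open>n\<close>, and its norm is at most \<open>\<Lambda>\<^sub>n\<close>. For \<open>p \<in> \<P>\<^sub>n\<close> this gives
  \<open>f - L\<^sub>n f = (f - p) - L\<^sub>n (f - p)\<close>, and hence Lebesgue's inequality
  \<open>d\<^sub>n(f,K) \<le> \<parallel>f - L\<^sub>n f\<parallel>\<^sub>K \<le> (1 + \<Lambda>\<^sub>n) d\<^sub>n(f,K)\<close>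
  (\<open>best_approx_le_interp_error\<close> and \<open>lebesgue_inequality\<close>). Reproduction of the constant 1 forces
  \<open>\<Lambda>\<^sub>n \<ge> 1\<close>, so that \<open>1 + \<Lambda>\<^sub>n \<le> 2 \<Lambda>\<^sub>n\<close>, and the assumption on the upper limit makes
  \<open>\<Lambda>\<^sub>n\<^sup>1\<^sup>/\<^sup>n\<close> an honest limit, equal to 1. The factor \<open>(2 \<Lambda>\<^sub>n)\<^sup>1\<^sup>/\<^sup>n\<close> therefore does not change
  the upper limit of \<open>d\<^sub>n(f,K)\<^sup>1\<^sup>/\<^sup>n\<close>.

  The projection property is Cramer's rule. If \<open>M\<close> is the Vandermonde matrix of the nodes and
  \<open>v(z)\<close> the vector of monomials at \<open>z\<close>, the quotients of determinants that define the Lagrange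
  polynomials are the entries of the solution \<open>x\<close> of \<open>M x = v(z)\<close>. Read as a formula for \<open>x\<close>,
  this says that the Lagrange polynomials are combinations of monomials; read as an equation for
  \<open>v(z)\<close>, it says that interpolation reproduces every monomial.
\<close>

section \<open>Lagrange interpolation reproduces polynomials\<close>

text \<open>Both halves come from the solution \<open>x = (det M)\<^sup>-\<^sup>1 adj(M) v(z)\<close> of \<open>M x = v(z)\<close>, whose entries
  Cramer's rule identifies with the Lagrange polynomials.\<close>

lemma lagrange_basis_cramer:
  fixes a :: "nat \<Rightarrow> complex ^ 'd::finite"
  assumes "vdm n a \<noteq> 0"
  defines "N \<equiv> ncoeffs TYPE('d) n"
  obtains C where
    "\<And>j z. j < N \<Longrightarrow> lagrange_basis n a j z = (\<Sum>i<N. C j i * cmonom (monom_enum n i) z)"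
    "\<And>i z. i < N \<Longrightarrow>
       cmonom (monom_enum n i) z = (\<Sum>j<N. cmonom (monom_enum n i) (a j) * lagrange_basis n a j z)"
proof -
  define M where "M = Matrix.mat N N (\<lambda>(i, j). cmonom (monom_enum n i) (a j))"
  define D where "D = Determinant.det M"
  define v where "v z = Matrix.vec N (\<lambda>i. cmonom (monom_enum n i) z)" for z :: "complex ^ 'd"
  define B where "B = inverse D \<cdot>\<^sub>m adj_mat M"
  have M: "M \<in> carrier_mat N N" and v: "v z \<in> carrier_vec N" for z
    by (simp_all add: M_def v_def)
  note adj = adj_mat[OF M]
  have B: "B \<in> carrier_mat N N"
    using adj(1) by (simp add: B_def)
  have D: "D = vdm n a" "D \<noteq> 0"
    using assms(1) by (simp_all add: D_def M_def N_def vdm_def)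
  have MB: "M * B = 1\<^sub>m N"
  proof -
    have "M * B = inverse D \<cdot>\<^sub>m (M * adj_mat M)"
      unfolding B_def by (rule mult_smult_distrib[OF M adj(1)])
    also have "\<dots> = 1\<^sub>m N"
      unfolding adj(2) D_def[symmetric] using D(2) by (intro eq_matI) auto
    finally show ?thesis .
  qed
  have sol: "M *\<^sub>v (B *\<^sub>v v z) = v z" for z
    using assoc_mult_mat_vec[OF M B v, of z] v[of z] by (simp add: MB)
  have lag: "lagrange_basis n a j z = vec_index (B *\<^sub>v v z) j" if j: "j < N" for j z
  proof -
    have "replace_col M (v z) j = Matrix.mat N N (\<lambda>(i, k). cmonom (monom_enum n i) ((a(j := z)) k))"
      unfolding replace_col_def by (rule eq_matI) (auto simp: M_def v_def)
    then have "vdm n (a(j := z)) = Determinant.det (replace_col M (v z) j)"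
      by (simp add: vdm_def N_def)
    also have "\<dots> = vec_index (B *\<^sub>v v z) j * D"
      using cramer_lemma_mat[OF M _ j, of "B *\<^sub>v v z"] B v[of z] by (simp add: sol D_def)
    finally show ?thesis
      using D by (simp add: lagrange_basis_def)
  qed
  show thesis
  proof (rule that)
    show "lagrange_basis n a j z = (\<Sum>i<N. B $$ (j, i) * cmonom (monom_enum n i) z)"
      if "j < N" for j z
      using that B by (simp add: lag scalar_prod_def v_def atLeast0LessThan)
    show "cmonom (monom_enum n i) z =
        (\<Sum>j<N. cmonom (monom_enum n i) (a j) * lagrange_basis n a j z)" if "i < N" for i z
    proof -
      have "cmonom (monom_enum n i) z = vec_index (M *\<^sub>v (B *\<^sub>v v z)) i"
        using that by (simp only: sol) (simp add: v_def)
      also have "\<dots> = (\<Sum>j<N. M $$ (i, j) * vec_index (B *\<^sub>v v z) j)"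
        using that M B by (simp add: scalar_prod_def atLeast0LessThan)
      also have "\<dots> = (\<Sum>j<N. cmonom (monom_enum n i) (a j) * lagrange_basis n a j z)"
        using that by (intro sum.cong refl) (auto simp: lag M_def)
      finally show ?thesis .
    qed
  qed
qed

lemma polys_upto_iff_enum:
  "p \<in> polys_upto n \<longleftrightarrow>
     (\<exists>c. \<forall>z :: complex ^ 'd::finite. p z = (\<Sum>i<ncoeffs TYPE('d) n. c i * cmonom (monom_enum n i) z))"
    (is "_ \<longleftrightarrow> ?R")
proof
  let ?e = "monom_enum n :: nat \<Rightarrow> 'd \<Rightarrow> nat" and ?N = "ncoeffs TYPE('d) n"
  note bij = bij_betw_monom_enum[of n, where ?'d = 'd]
  show ?R if "p \<in> polys_upto n"
  proof -
    from that obtain c where c: "p = (\<lambda>z. \<Sum>\<alpha>\<in>multi_indices n. c \<alpha> * cmonom \<alpha> z)"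
      by (auto simp: polys_upto_def)
    have "p z = (\<Sum>i<?N. c (?e i) * cmonom (?e i) z)" for z
      unfolding c by (rule sum.reindex_bij_betw[OF bij, symmetric])
    then show ?R by (intro exI[of _ "\<lambda>i. c (?e i)"]) simp
  qed
  assume ?R
  then obtain c where c: "\<And>z. p z = (\<Sum>i<?N. c i * cmonom (?e i) z)"
    by blast
  let ?c = "\<lambda>\<alpha>. c (the_inv_into {..<?N} ?e \<alpha>)"
  have "p z = (\<Sum>\<alpha>\<in>multi_indices n. ?c \<alpha> * cmonom \<alpha> z)" for z
  proof -
    have "(\<Sum>\<alpha>\<in>multi_indices n. ?c \<alpha> * cmonom \<alpha> z) = (\<Sum>i<?N. ?c (?e i) * cmonom (?e i) z)"
      by (rule sum.reindex_bij_betw[OF bij, symmetric])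
    also have "\<dots> = p z"
      unfolding c using bij by (intro sum.cong refl) (simp add: the_inv_into_f_f bij_betw_def)
    finally show ?thesis by simp
  qed
  then show "p \<in> polys_upto n"
    unfolding polys_upto_def mem_Collect_eq by (intro exI[of _ ?c] ext)
qed

lemma continuous_on_polys_upto:
  fixes p :: "complex ^ 'd::finite \<Rightarrow> complex"
  assumes "p \<in> polys_upto n"
  shows "continuous_on S p"
proof -
  obtain c where "p = (\<lambda>z. \<Sum>\<alpha>\<in>multi_indices n. c \<alpha> * cmonom \<alpha> z)"
    using assms by (auto simp: polys_upto_def)
  then show ?thesis
    by (auto simp: cmonom_def intro!: continuous_intros)
qed

lemma continuous_on_diff_polys_upto:
  fixes p :: "complex ^ 'd::finite \<Rightarrow> complex"
  assumes "continuous_on S f" "p \<in> polys_upto n"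
  shows "continuous_on S (\<lambda>z. f z - p z)"
  using assms(1) continuous_on_polys_upto[OF assms(2)] by (rule continuous_on_diff)

lemma zero_in_polys_upto: "(\<lambda>_. 0) \<in> polys_upto n"
  unfolding polys_upto_def by (auto intro!: exI[of _ "\<lambda>_. 0"])

lemma one_in_polys_upto: "(\<lambda>_ :: complex ^ 'd::finite. 1) \<in> polys_upto n"
proof -
  have "(\<Sum>\<alpha>\<in>multi_indices n. (if \<alpha> = (\<lambda>_. 0) then 1 else 0) * cmonom \<alpha> z) = 1"
    for z :: "complex ^ 'd"
  proof -
    have "(\<Sum>\<alpha>\<in>multi_indices n. (if \<alpha> = (\<lambda>_. 0) then 1 else 0) * cmonom \<alpha> z)
        = (\<Sum>\<alpha>\<in>(multi_indices n :: ('d \<Rightarrow> nat) set). if \<alpha> = (\<lambda>_. 0) then 1 else 0)"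
      by (intro sum.cong) (auto simp: cmonom_def)
    also have "\<dots> = 1"
      by (subst sum.delta) (auto simp: finite_multi_indices, simp add: multi_indices_def)
    finally show ?thesis .
  qed
  then show ?thesis
    unfolding polys_upto_def mem_Collect_eq
    by (intro exI[of _ "\<lambda>\<alpha>. if \<alpha> = (\<lambda>_. 0) then 1 else 0"]) simp
qed

lemma lagrange_interp_in_polys_upto:
  fixes a :: "nat \<Rightarrow> complex ^ 'd::finite"
  assumes "vdm n a \<noteq> 0"
  shows "lagrange_interp n a f \<in> polys_upto n"
proof -
  let ?N = "ncoeffs TYPE('d) n"
  obtain C where C: "\<And>j z. j < ?N \<Longrightarrow>
      lagrange_basis n a j z = (\<Sum>i<?N. C j i * cmonom (monom_enum n i) z)"
    using lagrange_basis_cramer[OF assms] by metis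
  have "lagrange_interp n a f z = (\<Sum>i<?N. (\<Sum>j<?N. f (a j) * C j i) * cmonom (monom_enum n i) z)" for z
  proof -
    have "lagrange_interp n a f z
        = (\<Sum>j<?N. \<Sum>i<?N. f (a j) * C j i * cmonom (monom_enum n i) z)"
      by (simp add: lagrange_interp_def C sum_distrib_left mult.assoc)
    also have "\<dots> = (\<Sum>i<?N. \<Sum>j<?N. f (a j) * C j i * cmonom (monom_enum n i) z)"
      by (rule sum.swap)
    finally show ?thesis
      by (simp add: sum_distrib_right)
  qed
  then show ?thesis
    unfolding polys_upto_iff_enum
    by (intro exI[of _ "\<lambda>i. \<Sum>j<?N. f (a j) * C j i"]) blast
qed

lemma lagrange_interp_reproduces_polys:
  fixes a :: "nat \<Rightarrow> complex ^ 'd::finite"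
  assumes "vdm n a \<noteq> 0" "p \<in> polys_upto n"
  shows "lagrange_interp n a p z = p z"
proof -
  let ?N = "ncoeffs TYPE('d) n"
  have mono: "cmonom (monom_enum n i) z =
      (\<Sum>j<?N. cmonom (monom_enum n i) (a j) * lagrange_basis n a j z)" if "i < ?N" for i
    using lagrange_basis_cramer[OF assms(1)] that by metis
  obtain c where c: "\<And>z. p z = (\<Sum>i<?N. c i * cmonom (monom_enum n i) z)"
    using assms(2) by (auto simp: polys_upto_iff_enum)
  have "lagrange_interp n a p z
      = (\<Sum>j<?N. \<Sum>i<?N. c i * (cmonom (monom_enum n i) (a j) * lagrange_basis n a j z))"
    by (simp add: lagrange_interp_def c sum_distrib_right mult.assoc)
  also have "\<dots> = (\<Sum>i<?N. \<Sum>j<?N. c i * (cmonom (monom_enum n i) (a j) * lagrange_basis n a j z))"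
    by (rule sum.swap)
  also have "\<dots> = (\<Sum>i<?N. c i * cmonom (monom_enum n i) z)"
    by (intro sum.cong refl) (simp add: mono sum_distrib_left[symmetric])
  finally show ?thesis by (simp add: c)
qed

lemma continuous_on_lagrange_basis:
  fixes a :: "nat \<Rightarrow> complex ^ 'd::finite"
  assumes "vdm n a \<noteq> 0" "j < ncoeffs TYPE('d) n"
  shows "continuous_on S (lagrange_basis n a j)"
proof -
  obtain C where "\<And>z. lagrange_basis n a j z =
      (\<Sum>i<ncoeffs TYPE('d) n. C j i * cmonom (monom_enum n i) z)"
    using lagrange_basis_cramer[OF assms(1)] assms(2) by metis
  then have "lagrange_basis n a j \<in> polys_upto n"
    unfolding polys_upto_iff_enum by (intro exI[of _ "C j"]) blast
  then show ?thesis
    by (rule continuous_on_polys_upto)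
qed

section \<open>Lebesgue's inequality\<close>

lemma norm_le_norm_on:
  assumes "compact K" "continuous_on K g" "z \<in> K"
  shows "norm (g z) \<le> norm_on K g"
  unfolding norm_on_def using assms
  by (intro cSUP_upper compact_imp_bounded bounded_imp_bdd_above compact_continuous_image
        continuous_intros) auto

lemma norm_on_le:
  assumes "K \<noteq> {}" "\<And>z. z \<in> K \<Longrightarrow> norm (g z) \<le> c"
  shows "norm_on K g \<le> c"
  unfolding norm_on_def using assms by (intro cSUP_least) auto

lemma norm_on_nonneg:
  assumes "compact K" "K \<noteq> {}" "continuous_on K g"
  shows "0 \<le> norm_on K g"
  using assms norm_le_norm_on[of K g] norm_ge_zero order_trans by (metis ex_in_conv)

lemma lagrange_basis_sum_le_lebesgue_const:
  fixes a :: "nat \<Rightarrow> complex ^ 'd::finite"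
  assumes "compact K" "vdm n a \<noteq> 0" "z \<in> K"
  shows "(\<Sum>j<ncoeffs TYPE('d) n. norm (lagrange_basis n a j z)) \<le> lebesgue_const K n a"
  unfolding lebesgue_const_def using assms
  by (intro cSUP_upper compact_imp_bounded bounded_imp_bdd_above compact_continuous_image
        continuous_intros continuous_on_lagrange_basis) auto

text \<open>At every point the Lagrange polynomials sum to 1, because interpolation reproduces the constant 1.\<close>

lemma lebesgue_const_ge_1:
  fixes a :: "nat \<Rightarrow> complex ^ 'd::finite"
  assumes "compact K" "K \<noteq> {}" "vdm n a \<noteq> 0"
  shows "1 \<le> lebesgue_const K n a"
proof -
  obtain z where z: "z \<in> K" using assms(2) by blast
  have "(\<Sum>j<ncoeffs TYPE('d) n. lagrange_basis n a j z) = 1"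
    using lagrange_interp_reproduces_polys[OF assms(3) one_in_polys_upto, of z]
    by (simp add: lagrange_interp_def)
  then have "1 \<le> (\<Sum>j<ncoeffs TYPE('d) n. norm (lagrange_basis n a j z))"
    by (metis norm_one norm_sum)
  also have "\<dots> \<le> lebesgue_const K n a"
    using assms(1,3) z by (rule lagrange_basis_sum_le_lebesgue_const)
  finally show ?thesis .
qed

lemma best_approx_nonneg:
  assumes "compact K" "K \<noteq> {}" "continuous_on K f"
  shows "0 \<le> best_approx n f K"
  unfolding best_approx_def
  using zero_in_polys_upto assms
  by (intro cINF_greatest norm_on_nonneg continuous_on_diff_polys_upto) auto

lemma best_approx_le:
  assumes "compact K" "K \<noteq> {}" "continuous_on K f" "p \<in> polys_upto n"
  shows "best_approx n f K \<le> norm_on K (\<lambda>z. f z - p z)"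
  unfolding best_approx_def
proof (rule cINF_lower)
  show "bdd_below ((\<lambda>p. norm_on K (\<lambda>z. f z - p z)) ` polys_upto n)"
    using assms(1-3)
    by (intro bdd_belowI2[where m = 0] norm_on_nonneg continuous_on_diff_polys_upto) auto
qed fact

lemma best_approx_le_interp_error:
  assumes "compact K" "K \<noteq> {}" "continuous_on K f" "vdm n a \<noteq> 0"
  shows "best_approx n f K \<le> norm_on K (\<lambda>z. f z - lagrange_interp n a f z)"
  using best_approx_le[OF assms(1-3) lagrange_interp_in_polys_upto[OF assms(4)]] .

text \<open>Subtracting any \<open>p \<in> \<P>\<^sub>n\<close> leaves the interpolation error unchanged, so the error of \<open>f\<close>
  is that of \<open>f - p\<close>, which is bounded by the operator norm of \<open>id - L\<^sub>n\<close>. The infimum over \<open>p\<close>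
  is taken after dividing by \<open>1 + \<Lambda>\<^sub>n\<close>, which avoids having to know that a best approximation
  exists.\<close>

lemma lebesgue_inequality:
  fixes a :: "nat \<Rightarrow> complex ^ 'd::finite"
  assumes "compact K" "K \<noteq> {}" "continuous_on K f" "vdm n a \<noteq> 0"
    and nodes: "\<And>j. j < ncoeffs TYPE('d) n \<Longrightarrow> a j \<in> K"
  shows "norm_on K (\<lambda>z. f z - lagrange_interp n a f z)
       \<le> (1 + lebesgue_const K n a) * best_approx n f K"
proof -
  let ?N = "ncoeffs TYPE('d) n" and ?\<Lambda> = "lebesgue_const K n a"
    and ?E = "norm_on K (\<lambda>z. f z - lagrange_interp n a f z)"
  have \<Lambda>: "1 \<le> ?\<Lambda>"
    using assms by (intro lebesgue_const_ge_1)
  have main: "?E \<le> (1 + ?\<Lambda>) * norm_on K (\<lambda>z. f z - p z)" if p: "p \<in> polys_upto n" for p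
  proof (rule norm_on_le[OF assms(2)])
    fix z assume z: "z \<in> K"
    define g where "g = (\<lambda>z. f z - p z)"
    have g: "continuous_on K g"
      unfolding g_def using assms(3) p by (rule continuous_on_diff_polys_upto)
    have "lagrange_interp n a g z = lagrange_interp n a f z - lagrange_interp n a p z"
      by (simp add: lagrange_interp_def g_def left_diff_distrib sum_subtractf)
    then have "f z - lagrange_interp n a f z = g z - lagrange_interp n a g z"
      using lagrange_interp_reproduces_polys[OF assms(4) p] by (simp add: g_def)
    then have "norm (f z - lagrange_interp n a f z) \<le> norm (g z) + norm (lagrange_interp n a g z)"
      by (simp add: norm_triangle_ineq4)
    moreover have "norm (lagrange_interp n a g z) \<le> ?\<Lambda> * norm_on K g"
    proof -
      have "norm (lagrange_interp n a g z) \<le> (\<Sum>j<?N. norm_on K g * norm (lagrange_basis n a j z))"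
        unfolding lagrange_interp_def norm_mult
        using norm_le_norm_on[OF assms(1) g nodes]
        by (intro sum_norm_le) (auto simp: norm_mult intro!: mult_right_mono)
      also have "\<dots> = norm_on K g * (\<Sum>j<?N. norm (lagrange_basis n a j z))"
        by (simp add: sum_distrib_left)
      also have "\<dots> \<le> norm_on K g * ?\<Lambda>"
        using lagrange_basis_sum_le_lebesgue_const[OF assms(1,4) z] norm_on_nonneg[OF assms(1,2) g]
        by (intro mult_left_mono)
      finally show ?thesis by (simp add: mult.commute)
    qed
    moreover have "norm (g z) \<le> norm_on K g"
      using norm_le_norm_on[OF assms(1) g z] .
    ultimately have "norm (f z - lagrange_interp n a f z) \<le> norm_on K g + ?\<Lambda> * norm_on K g"
      by linarith
    then show "norm (f z - lagrange_interp n a f z) \<le> (1 + ?\<Lambda>) * norm_on K (\<lambda>z. f z - p z)"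
      by (simp add: g_def distrib_right)
  qed
  have "?E / (1 + ?\<Lambda>) \<le> best_approx n f K"
    unfolding best_approx_def
  proof (rule cINF_greatest)
    show "?E / (1 + ?\<Lambda>) \<le> norm_on K (\<lambda>z. f z - p z)" if "p \<in> polys_upto n" for p
      using main[OF that] \<Lambda> by (simp add: divide_le_eq mult.commute)
  qed (use zero_in_polys_upto in blast)
  then show ?thesis
    using \<Lambda> by (simp add: divide_le_eq mult.commute)
qed

section \<open>Comparison of the root asymptotics\<close>

text \<open>A factor with limit 1 can be pulled out of an upper limit in the extended reals whatever the
  other factor does, so neither the sign nor the growth of \<open>v\<close> has to be controlled.\<close>

lemma limsup_root_eq_of_subexponential_ratio:
  fixes u v w :: "nat \<Rightarrow> real"
  assumes v: "\<And>n. n \<ge> 1 \<Longrightarrow> v n \<le> u n"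
    and u: "\<And>n. n \<ge> 1 \<Longrightarrow> u n \<le> w n * v n"
    and w: "(\<lambda>n. root n (w n)) \<longlonglongrightarrow> 1"
  shows "limsup (\<lambda>n. ereal (root n (u n))) = limsup (\<lambda>n. ereal (root n (v n)))"
proof (rule antisym)
  have "limsup (\<lambda>n. ereal (root n (u n))) \<le> limsup (\<lambda>n. ereal (root n (w n)) * ereal (root n (v n)))"
    using u by (intro Limsup_mono eventually_sequentiallyI[of 1])
               (simp add: real_root_mult[symmetric])
  also have "\<dots> = 1 * limsup (\<lambda>n. ereal (root n (v n)))"
    using w by (intro ereal_limsup_lim_mult) (auto simp: one_ereal_def)
  finally show "limsup (\<lambda>n. ereal (root n (u n))) \<le> limsup (\<lambda>n. ereal (root n (v n)))"
    by simp
  show "limsup (\<lambda>n. ereal (root n (v n))) \<le> limsup (\<lambda>n. ereal (root n (u n)))"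
    using v by (intro Limsup_mono eventually_sequentiallyI[of 1]) simp
qed

theorem proposition3:
  fixes K :: "(complex ^ 'd::finite) set"
    and A :: "nat \<Rightarrow> nat \<Rightarrow> complex ^ 'd"
    and f :: "complex ^ 'd \<Rightarrow> complex"
  assumes "compact K"
    and "polynomially_convex K"
    and "L_regular K"
    and "\<And>n j. n \<ge> 1 \<Longrightarrow> j < ncoeffs TYPE('d) n \<Longrightarrow> A n j \<in> K"
    and "\<And>n. n \<ge> 1 \<Longrightarrow> vdm n (A n) \<noteq> 0"
    and "limsup (\<lambda>n. ereal (root n (lebesgue_const K n (A n)))) = 1"
    and "continuous_on K f"
  shows "limsup (\<lambda>n. ereal (root n (norm_on K (\<lambda>z. f z - lagrange_interp n (A n) f z))))
       = limsup (\<lambda>n. ereal (root n (best_approx n f K)))"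
proof -
  let ?\<Lambda> = "\<lambda>n. lebesgue_const K n (A n)"
  \<comment> \<open>The suprema over \<open>K\<close> are meaningful only because the nodes witness that \<open>K\<close> is nonempty.\<close>
  have "A 1 0 \<in> K"
    using assms(4)[of 1 0] by (simp add: ncoeffs_def)
  then have K: "K \<noteq> {}" by blast
  have \<Lambda>: "1 \<le> ?\<Lambda> n" if "n \<ge> 1" for n
    using lebesgue_const_ge_1[OF assms(1) K assms(5)[OF that]] .
  have "(\<lambda>n. root n (?\<Lambda> n)) \<longlonglongrightarrow> 1"
  proof (rule limsup_le_liminf_real)
    show "limsup (\<lambda>n. ereal (root n (?\<Lambda> n))) \<le> ereal 1"
      using assms(6) by (simp add: one_ereal_def)
    show "ereal 1 \<le> liminf (\<lambda>n. ereal (root n (?\<Lambda> n)))"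
      using \<Lambda> by (intro Liminf_bounded eventually_sequentiallyI[of 1]) simp
  qed
  then have w: "(\<lambda>n. root n (2 * ?\<Lambda> n)) \<longlonglongrightarrow> 1"
    using tendsto_mult[OF LIMSEQ_root_const[of 2]] by (simp add: real_root_mult)
  show ?thesis
  proof (rule limsup_root_eq_of_subexponential_ratio[OF _ _ w])
    fix n :: nat assume n: "n \<ge> 1"
    show "best_approx n f K \<le> norm_on K (\<lambda>z. f z - lagrange_interp n (A n) f z)"
      using assms(1) K assms(7) assms(5)[OF n] by (rule best_approx_le_interp_error)
    have "norm_on K (\<lambda>z. f z - lagrange_interp n (A n) f z) \<le> (1 + ?\<Lambda> n) * best_approx n f K"
      using lebesgue_inequality[OF assms(1) K assms(7) assms(5)[OF n] assms(4)[OF n]] .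
    also have "\<dots> \<le> (2 * ?\<Lambda> n) * best_approx n f K"
      using \<Lambda>[OF n] best_approx_nonneg[OF assms(1) K assms(7)] by (intro mult_right_mono) auto
    finally show "norm_on K (\<lambda>z. f z - lagrange_interp n (A n) f z) \<le> (2 * ?\<Lambda> n) * best_approx n f K" .
  qed
qed

end
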